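(* Let $B$ be an infinite set. (a) Let $E$ be a lim-rim over $B$ with ultrafilter $\mathcal L$, and let $\mathcal U$ be any ultrafilter on (all subsets of) the set $B^E$ extending $\mathcal L$. Map $E$ into the ultrapower $B^{B^E}/\mathcal U$ by sending $e\in E$ to the class of the coordinate map $\psi\mapsto\psi_e$. Then for every $n$, every $R\subset B^n$ and all $e_1,\dots,e_n\in E$, the tuple $(e_1,\dots,e_n)$ ${}^*$-satisfies $R$ in the lim-rim $E$ if and only if the tuple of images satisfies $R$ modulo $\mathcal U$ in the ultrapower. (b) Conversely, let $S$ be a set, $\mathcal U$ an ultrafilter on $S$, and $E$ a subset of the ultrapower $B^S/\mathcal U$. Choose a lifting $e\mapsto\tilde e\in B^S$ of $E$, and let $S\to B^E$ be the map $s\mapsto(\tilde e(s))_{e\in E}$. Push $\mathcal U$ forward along this map to an ultrafilter on $B^E$, and let $\mathcal L$ be its restriction to the cylinder Boolean algebra of $B^E$. Then $\mathcal L$ does not depend on the choice of the lifting, and it makes $E$ a lim-rim over $B$ such that for every $n$, $R\subset B^n$ and $e_1,\dots,e_n\in E$, the tuple $(e_1,\dots,e_n)$ ${}^*$-satisfies $R$ in this lim-rim if and only if it satisfies $R$ modulo $\mathcal U$ in the ultrapower.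
   Context: For sets $B,E$, a cylinder of $B^E$ is a subset of the form $\{\psi\in B^E:\psi|_J\in R\}$ with $J\subset E$ finite and $R\subset B^J$; the cylinders form a Boolean algebra. A lim-rim over $B$ is a set $E$ together with an ultrafilter $\mathcal L$ in the cylinder Boolean algebra of $B^E$. A tuple $(e_1,\dots,e_n)\in E^n$ ${}^*$-satisfies $R\subset B^n$ in the lim-rim if $\{\psi\in B^E:(\psi_{e_1},\dots,\psi_{e_n})\in R\}\in\mathcal L$. In an ultrapower $B^S/\mathcal U$ (functions $S\to B$ modulo equality on a member of $\mathcal U$), a tuple $([f_1],\dots,[f_n])$ satisfies $R$ modulo $\mathcal U$ if $\{s\in S:(f_1(s),\dots,f_n(s))\in R\}\in\mathcal U$. *)

theory Defs
  imports "HOL-Library.FuncSet" "HOL-Analysis.Sigma_Algebra"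
begin

text \<open>The power \<open>B\<^sup>E\<close> is the set \<open>E \<rightarrow>\<^sub>E B\<close> of extensional functions. An \<open>n\<close>-tuple is
  a list of length \<open>n\<close>, and \<open>n = 0\<close> is allowed.\<close>

definition tuples :: "'a set \<Rightarrow> nat \<Rightarrow> 'a list set" where
  "tuples A n = {xs. set xs \<subseteq> A \<and> length xs = n}"

text \<open>With \<open>M = Pow \<Omega>\<close> this is an ultrafilter on the set \<open>\<Omega>\<close>.\<close>

locale set_ultrafilter = algebra \<Omega> M for \<Omega> :: "'a set" and M :: "'a set set" +
  fixes F :: "'a set set"
  assumes F_subset: "F \<subseteq> M"
    and F_space: "\<Omega> \<in> F"
    and F_empty: "{} \<notin> F"
    and F_Int: "X \<in> F \<Longrightarrow> Y \<in> F \<Longrightarrow> X \<inter> Y \<in> F"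
    and F_mono: "X \<in> F \<Longrightarrow> Y \<in> M \<Longrightarrow> X \<subseteq> Y \<Longrightarrow> Y \<in> F"
    and F_ultra: "X \<in> M \<Longrightarrow> X \<in> F \<or> \<Omega> - X \<in> F"

definition cylinders :: "'b set \<Rightarrow> 'e set \<Rightarrow> ('e \<Rightarrow> 'b) set set" where
  "cylinders B E =
    {{\<psi> \<in> E \<rightarrow>\<^sub>E B. restrict \<psi> J \<in> R} | J R. finite J \<and> J \<subseteq> E \<and> R \<subseteq> (J \<rightarrow>\<^sub>E B)}"

lemma algebra_cylinders:
  fixes B :: "'b set" and E :: "'e set"
  shows "algebra (E \<rightarrow>\<^sub>E B) (cylinders B E)"
proof -
  have "{} \<in> cylinders B E"
    unfolding cylinders_def by blast
  moreover have "(E \<rightarrow>\<^sub>E B) - X \<in> cylinders B E" if "X \<in> cylinders B E" for X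
  proof -
    obtain J R where J: "finite J" "J \<subseteq> E" and X: "X = {\<psi> \<in> E \<rightarrow>\<^sub>E B. restrict \<psi> J \<in> R}"
      using \<open>X \<in> cylinders B E\<close> unfolding cylinders_def by blast
    have "restrict \<psi> J \<in> J \<rightarrow>\<^sub>E B" if "\<psi> \<in> E \<rightarrow>\<^sub>E B" for \<psi>
      using PiE_mem[OF that] J(2) by (intro restrict_PiE_iff[THEN iffD2]) blast
    then have "(E \<rightarrow>\<^sub>E B) - X = {\<psi> \<in> E \<rightarrow>\<^sub>E B. restrict \<psi> J \<in> (J \<rightarrow>\<^sub>E B) - R}"
      unfolding X by blast
    then show ?thesis
      unfolding cylinders_def using J by blast
  qed
  moreover have "X \<union> Y \<in> cylinders B E" if "X \<in> cylinders B E" "Y \<in> cylinders B E" for X Y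
  proof -
    obtain J R where J: "finite J" "J \<subseteq> E" and X: "X = {\<psi> \<in> E \<rightarrow>\<^sub>E B. restrict \<psi> J \<in> R}"
      using \<open>X \<in> cylinders B E\<close> unfolding cylinders_def by blast
    obtain K Q where K: "finite K" "K \<subseteq> E" and Y: "Y = {\<psi> \<in> E \<rightarrow>\<^sub>E B. restrict \<psi> K \<in> Q}"
      using \<open>Y \<in> cylinders B E\<close> unfolding cylinders_def by blast
    let ?P = "{\<rho> \<in> (J \<union> K) \<rightarrow>\<^sub>E B. restrict \<rho> J \<in> R \<or> restrict \<rho> K \<in> Q}"
    have "restrict \<psi> (J \<union> K) \<in> (J \<union> K) \<rightarrow>\<^sub>E B" if "\<psi> \<in> E \<rightarrow>\<^sub>E B" for \<psi>
      using PiE_mem[OF that] J(2) K(2) by (intro restrict_PiE_iff[THEN iffD2]) blast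
    moreover have "restrict (restrict \<psi> (J \<union> K)) J = restrict \<psi> J"
        "restrict (restrict \<psi> (J \<union> K)) K = restrict \<psi> K" for \<psi> :: "'e \<Rightarrow> 'b"
      by (simp_all add: restrict_restrict Int_absorb1)
    ultimately have "X \<union> Y = {\<psi> \<in> E \<rightarrow>\<^sub>E B. restrict \<psi> (J \<union> K) \<in> ?P}"
      unfolding X Y by simp blast
    moreover have "finite (J \<union> K)" "J \<union> K \<subseteq> E" "?P \<subseteq> ((J \<union> K) \<rightarrow>\<^sub>E B)"
      using J K by auto
    ultimately show ?thesis
      unfolding cylinders_def by blast
  qed
  ultimately show ?thesis
    unfolding algebra_iff_Un by (auto simp: cylinders_def)
qed

definition lim_rim :: "'b set \<Rightarrow> 'e set \<Rightarrow> ('e \<Rightarrow> 'b) set set \<Rightarrow> bool" where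
  "lim_rim B E L \<longleftrightarrow> set_ultrafilter (E \<rightarrow>\<^sub>E B) (cylinders B E) L"

definition star_satisfies ::
    "'b set \<Rightarrow> 'e set \<Rightarrow> ('e \<Rightarrow> 'b) set set \<Rightarrow> 'b list set \<Rightarrow> 'e list \<Rightarrow> bool" where
  "star_satisfies B E L R es \<longleftrightarrow> {\<psi> \<in> E \<rightarrow>\<^sub>E B. map \<psi> es \<in> R} \<in> L"

definition ultra_rel :: "'b set \<Rightarrow> 's set \<Rightarrow> 's set set \<Rightarrow> ('s \<Rightarrow> 'b) rel" where
  "ultra_rel B S U = {(f, g). f \<in> S \<rightarrow>\<^sub>E B \<and> g \<in> S \<rightarrow>\<^sub>E B \<and> {s \<in> S. f s = g s} \<in> U}"

definition ultra_class :: "'b set \<Rightarrow> 's set \<Rightarrow> 's set set \<Rightarrow> ('s \<Rightarrow> 'b) \<Rightarrow> ('s \<Rightarrow> 'b) set" where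
  "ultra_class B S U f = ultra_rel B S U `` {f}"

definition ultrapower :: "'b set \<Rightarrow> 's set \<Rightarrow> 's set set \<Rightarrow> ('s \<Rightarrow> 'b) set set" where
  "ultrapower B S U = (S \<rightarrow>\<^sub>E B) // ultra_rel B S U"

text \<open>Satisfaction is a property of tuples of classes, stated through some choice of
  representatives. By \<open>satisfies_mod_classes\<close> below, the choice is irrelevant.\<close>

definition satisfies_mod ::
    "'b set \<Rightarrow> 's set \<Rightarrow> 's set set \<Rightarrow> 'b list set \<Rightarrow> ('s \<Rightarrow> 'b) set list \<Rightarrow> bool" where
  "satisfies_mod B S U R cs \<longleftrightarrow>
    (\<exists>fs. set fs \<subseteq> (S \<rightarrow>\<^sub>E B) \<and> cs = map (ultra_class B S U) fs
       \<and> {s \<in> S. map (\<lambda>f. f s) fs \<in> R} \<in> U)"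

lemma equiv_ultra_rel:
  assumes "set_ultrafilter S (Pow S) U"
  shows "equiv (S \<rightarrow>\<^sub>E B) (ultra_rel B S U)"
proof -
  interpret set_ultrafilter S "Pow S" U by fact
  have "{s \<in> S. f s = h s} \<in> U" if "{s \<in> S. f s = g s} \<in> U" "{s \<in> S. g s = h s} \<in> U"
    for f g h :: "'a \<Rightarrow> 'b"
    by (rule F_mono[OF F_Int[OF that]]) auto
  then have "trans (ultra_rel B S U)"
    unfolding trans_def ultra_rel_def by blast
  moreover have "sym (ultra_rel B S U)"
    unfolding sym_def ultra_rel_def by (simp add: eq_commute)
  moreover have "refl_on (S \<rightarrow>\<^sub>E B) (ultra_rel B S U)"
    unfolding refl_on_def ultra_rel_def using F_space by auto
  moreover have "ultra_rel B S U \<subseteq> (S \<rightarrow>\<^sub>E B) \<times> (S \<rightarrow>\<^sub>E B)"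
    unfolding ultra_rel_def by auto
  ultimately show ?thesis
    by (simp add: equiv_def)
qed

lemma satisfies_mod_classes:
  assumes U: "set_ultrafilter S (Pow S) U" and fs: "set fs \<subseteq> (S \<rightarrow>\<^sub>E B)"
  shows "satisfies_mod B S U R (map (ultra_class B S U) fs)
    \<longleftrightarrow> {s \<in> S. map (\<lambda>f. f s) fs \<in> R} \<in> U"
proof
  interpret set_ultrafilter S "Pow S" U by fact
  have agree: "{s \<in> S. map (\<lambda>f. f s) gs = map (\<lambda>f. f s) fs} \<in> U"
    if "map (ultra_class B S U) fs = map (ultra_class B S U) gs"
      "set fs \<subseteq> (S \<rightarrow>\<^sub>E B)" "set gs \<subseteq> (S \<rightarrow>\<^sub>E B)" for fs gs :: "('a \<Rightarrow> 'b) list"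
    using that
  proof (induction fs arbitrary: gs)
    case Nil
    then show ?case using F_space by simp
  next
    case (Cons f fs)
    then obtain g gs' where gs: "gs = g # gs'" by (cases gs) auto
    have "(f, g) \<in> ultra_rel B S U"
      using Cons.prems gs eq_equiv_class_iff[OF equiv_ultra_rel[OF U], of f B g]
      by (simp add: ultra_class_def)
    then have *: "{s \<in> S. f s = g s} \<in> U"
      by (simp add: ultra_rel_def)
    have "{s \<in> S. map (\<lambda>f. f s) gs' = map (\<lambda>f. f s) fs} \<in> U"
      
      by (rule Cons.IH) (use Cons.prems gs in simp_all)
    from F_Int[OF * this] show ?case
      by (rule F_mono) (simp_all add: gs subset_iff)
  qed
  show "{s \<in> S. map (\<lambda>f. f s) fs \<in> R} \<in> U"
    if sat: "satisfies_mod B S U R (map (ultra_class B S U) fs)"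
  proof -
    obtain gs where gs: "set gs \<subseteq> (S \<rightarrow>\<^sub>E B)"
        "map (ultra_class B S U) fs = map (ultra_class B S U) gs"
        "{s \<in> S. map (\<lambda>f. f s) gs \<in> R} \<in> U"
      using sat unfolding satisfies_mod_def by blast
    show ?thesis
    proof (rule F_mono[OF F_Int[OF gs(3) agree[OF gs(2) fs gs(1)]]])
      show "{s \<in> S. map (\<lambda>f. f s) fs \<in> R} \<in> Pow S" by blast
      show "{s \<in> S. map (\<lambda>f. f s) gs \<in> R} \<inter> {s \<in> S. map (\<lambda>f. f s) gs = map (\<lambda>f. f s) fs}
          \<subseteq> {s \<in> S. map (\<lambda>f. f s) fs \<in> R}"
        by (rule subsetI) (simp only: Int_iff mem_Collect_eq, metis)
    qed
  qed
next
  show "satisfies_mod B S U R (map (ultra_class B S U) fs)"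
    if "{s \<in> S. map (\<lambda>f. f s) fs \<in> R} \<in> U"
    unfolding satisfies_mod_def using that fs by blast
qed

definition lifting ::
    "'b set \<Rightarrow> 's set \<Rightarrow> 's set set \<Rightarrow> ('s \<Rightarrow> 'b) set set \<Rightarrow> (('s \<Rightarrow> 'b) set \<Rightarrow> 's \<Rightarrow> 'b) \<Rightarrow> bool" where
  "lifting B S U E l \<longleftrightarrow> (\<forall>e\<in>E. l e \<in> S \<rightarrow>\<^sub>E B \<and> ultra_class B S U (l e) = e)"

lemma lifting_exists:
  assumes "E \<subseteq> ultrapower B S U"
  shows "\<exists>l. lifting B S U E l"
proof -
  have "\<forall>e\<in>E. \<exists>f. f \<in> S \<rightarrow>\<^sub>E B \<and> ultra_class B S U f = e"
    using assms unfolding ultrapower_def quotient_def ultra_class_def by blast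
  then show ?thesis
    unfolding lifting_def by (rule bchoice)
qed

definition lift_map :: "'e set \<Rightarrow> ('e \<Rightarrow> 's \<Rightarrow> 'b) \<Rightarrow> 's \<Rightarrow> 'e \<Rightarrow> 'b" where
  "lift_map E l s = (\<lambda>e\<in>E. l e s)"

definition pushforward :: "'s set \<Rightarrow> 's set set \<Rightarrow> 't set \<Rightarrow> ('s \<Rightarrow> 't) \<Rightarrow> 't set set" where
  "pushforward S U T h = {A. A \<subseteq> T \<and> {s \<in> S. h s \<in> A} \<in> U}"

definition induced_L ::
    "'b set \<Rightarrow> 's set \<Rightarrow> 's set set \<Rightarrow> 'e set \<Rightarrow> ('e \<Rightarrow> 's \<Rightarrow> 'b) \<Rightarrow> ('e \<Rightarrow> 'b) set set" where
  "induced_L B S U E l = pushforward S U (E \<rightarrow>\<^sub>E B) (lift_map E l) \<inter> cylinders B E"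

end

theory Submission imports Defs begin

text \<open>
  Everything rests on one description of the cylinder algebra: the cylinders of \<open>B\<^sup>E\<close> are
  exactly the events \<open>{\<psi>. (\<psi>\<^sub>e\<^sub>1, \<dots>, \<psi>\<^sub>e\<^sub>n) \<in> R}\<close> whose membership in \<open>\<L>\<close> is what
  \<open>*\<close>-satisfaction asks (\<open>cylinders_eq_tuple_events\<close>). So \<open>\<L>\<close> and \<open>*\<close>-satisfaction
  are the same data.

  For (a), an ultrafilter \<open>\<U>\<close> containing \<open>\<L>\<close> adds no new cylinder, because an ultrafilter
  is a maximal filter (\<open>ultrafilter_extension_iff\<close>). Both sides of the equivalence then say
  that the same event lies in \<open>\<L>\<close>, respectively in \<open>\<U>\<close>.

  For (b), ultrafilters can be pushed forward along maps and restricted to subalgebras, which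
  makes \<open>E\<close> a lim-rim. The preimage of a tuple event under the map \<open>S \<rightarrow> B\<^sup>E\<close> is the set
  of those \<open>s\<close> at which the chosen representatives satisfy \<open>R\<close>, so \<open>*\<close>-satisfaction is
  satisfaction modulo \<open>\<U>\<close> (\<open>star_satisfies_induced_L\<close>). The latter does not mention the
  lifting. As every cylinder is a tuple event, \<open>\<L>\<close> does not depend on the lifting either.
\<close>

text \<open>The relation for a cylinder over \<open>J\<close> comes from listing the finite set \<open>J\<close>: a function
  on \<open>J\<close> is determined by its list of values. Conversely, the coordinates in a tuple may repeat,
  which is harmless because only the set of coordinates serves as \<open>J\<close>.\<close>

lemma cylinders_eq_tuple_events:
  "cylinders B E = {{\<psi> \<in> E \<rightarrow>\<^sub>E B. map \<psi> es \<in> R} | es R. set es \<subseteq> E}"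
proof (intro subset_antisym subsetI)
  fix X assume "X \<in> cylinders B E"
  then obtain J R where J: "finite J" "J \<subseteq> E" and R: "R \<subseteq> J \<rightarrow>\<^sub>E B"
    and X: "X = {\<psi> \<in> E \<rightarrow>\<^sub>E B. restrict \<psi> J \<in> R}"
    unfolding cylinders_def by blast
  obtain js where js: "set js = J"
    using finite_list[OF J(1)] by blast
  have "restrict \<psi> J \<in> R \<longleftrightarrow> map \<psi> js \<in> (\<lambda>\<rho>. map \<rho> js) ` R" for \<psi>
  proof
    assume "restrict \<psi> J \<in> R"
    moreover have "map \<psi> js = map (restrict \<psi> J) js"
      using js by simp
    ultimately show "map \<psi> js \<in> (\<lambda>\<rho>. map \<rho> js) ` R"
      by blast
  next
    assume "map \<psi> js \<in> (\<lambda>\<rho>. map \<rho> js) ` R"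
    then obtain \<rho> where \<rho>: "\<rho> \<in> R" "\<forall>j\<in>J. \<psi> j = \<rho> j"
      using js by auto
    have "restrict \<psi> J = \<rho>"
      using \<rho> R by (intro extensionalityI[of _ J]) (auto simp: PiE_def)
    with \<rho>(1) show "restrict \<psi> J \<in> R"
      by simp
  qed
  then show "X \<in> {{\<psi> \<in> E \<rightarrow>\<^sub>E B. map \<psi> es \<in> R} | es R. set es \<subseteq> E}"
    using X J(2) js by blast
next
  fix X assume "X \<in> {{\<psi> \<in> E \<rightarrow>\<^sub>E B. map \<psi> es \<in> R} | es R. set es \<subseteq> E}"
  then obtain es R where es: "set es \<subseteq> E" and X: "X = {\<psi> \<in> E \<rightarrow>\<^sub>E B. map \<psi> es \<in> R}"
    by blast
  let ?Q = "{\<rho> \<in> set es \<rightarrow>\<^sub>E B. map \<rho> es \<in> R}"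
  have "map \<psi> es \<in> R \<longleftrightarrow> restrict \<psi> (set es) \<in> ?Q" if "\<psi> \<in> E \<rightarrow>\<^sub>E B" for \<psi>
  proof -
    have "map (restrict \<psi> (set es)) es = map \<psi> es"
      by simp
    moreover have "restrict \<psi> (set es) \<in> set es \<rightarrow>\<^sub>E B"
      using PiE_mem[OF that] es by (intro restrict_PiE_iff[THEN iffD2]) blast
    ultimately show ?thesis
      by (simp only: mem_Collect_eq simp_thms)
  qed
  then have "X = {\<psi> \<in> E \<rightarrow>\<^sub>E B. restrict \<psi> (set es) \<in> ?Q}"
    unfolding X by (intro Collect_cong conj_cong refl)
  moreover have "finite (set es)" "?Q \<subseteq> set es \<rightarrow>\<^sub>E B"
    by auto
  ultimately show "X \<in> cylinders B E"
    unfolding cylinders_def using es by blast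
qed

lemma tuple_event_cylinder:
  "set es \<subseteq> E \<Longrightarrow> {\<psi> \<in> E \<rightarrow>\<^sub>E B. map \<psi> es \<in> R} \<in> cylinders B E"
  unfolding cylinders_eq_tuple_events by blast

text \<open>If a set of the smaller algebra were in \<open>U\<close> but not in \<open>L\<close>, its complement would be in
  \<open>L\<close>, hence in \<open>U\<close>, and \<open>U\<close> would contain the empty set.\<close>

lemma ultrafilter_extension_iff:
  assumes L: "set_ultrafilter \<Omega> M L" and U: "set_ultrafilter \<Omega> N U"
    and "L \<subseteq> U" and "X \<in> M"
  shows "X \<in> L \<longleftrightarrow> X \<in> U"
proof
  show "X \<in> U" if "X \<in> L"
    using that \<open>L \<subseteq> U\<close> by blast
  show "X \<in> L" if "X \<in> U"
  proof (rule ccontr)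
    assume "X \<notin> L"
    then have "\<Omega> - X \<in> U"
      using set_ultrafilter.F_ultra[OF L \<open>X \<in> M\<close>] \<open>L \<subseteq> U\<close> by blast
    then have "X \<inter> (\<Omega> - X) \<in> U"
      by (rule set_ultrafilter.F_Int[OF U \<open>X \<in> U\<close>])
    then show False
      using set_ultrafilter.F_empty[OF U] by simp
  qed
qed

lemma set_ultrafilter_pushforward:
  assumes U: "set_ultrafilter S (Pow S) U" and h: "h \<in> S \<rightarrow> T"
  shows "set_ultrafilter T (Pow T) (pushforward S U T h)"
proof -
  interpret U: set_ultrafilter S "Pow S" U by fact
  let ?F = "pushforward S U T h"
  have F: "A \<in> ?F \<longleftrightarrow> A \<subseteq> T \<and> {s \<in> S. h s \<in> A} \<in> U" for A
    by (simp add: pushforward_def)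
  show ?thesis
  proof (intro set_ultrafilter.intro set_ultrafilter_axioms.intro)
    show "algebra T (Pow T)"
      by (rule algebra_Pow)
    show "?F \<subseteq> Pow T"
      using F by blast
    have "{s \<in> S. h s \<in> T} = S"
      using h by blast
    then show "T \<in> ?F"
      using F U.F_space by simp
    show "{} \<notin> ?F"
      using F U.F_empty by simp
    show "X \<inter> Y \<in> ?F" if "X \<in> ?F" "Y \<in> ?F" for X Y
    proof -
      have "{s \<in> S. h s \<in> X \<inter> Y} = {s \<in> S. h s \<in> X} \<inter> {s \<in> S. h s \<in> Y}"
        by blast
      with that U.F_Int show ?thesis
        by (simp add: F le_infI1)
    qed
    show "Y \<in> ?F" if "X \<in> ?F" "Y \<in> Pow T" "X \<subseteq> Y" for X Y
    proof -
      have "{s \<in> S. h s \<in> Y} \<in> U"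
        by (rule U.F_mono[of "{s \<in> S. h s \<in> X}"]) (use that F in auto)
      with that(2) F show ?thesis
        by blast
    qed
    show "X \<in> ?F \<or> T - X \<in> ?F" if "X \<in> Pow T" for X
    proof -
      have "{s \<in> S. h s \<in> T - X} = S - {s \<in> S. h s \<in> X}"
        using h by blast
      moreover have "{s \<in> S. h s \<in> X} \<in> U \<or> S - {s \<in> S. h s \<in> X} \<in> U"
        by (rule U.F_ultra) blast
      ultimately show ?thesis
        using that by (auto simp: F)
    qed
  qed
qed

lemma set_ultrafilter_restrict:
  assumes U: "set_ultrafilter \<Omega> N U" and M: "algebra \<Omega> M" and "M \<subseteq> N"
  shows "set_ultrafilter \<Omega> M (U \<inter> M)"
proof -
  interpret U: set_ultrafilter \<Omega> N U by fact
  interpret M: algebra \<Omega> M by fact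
  show ?thesis
  proof
    show "\<Omega> \<in> U \<inter> M"
      using U.F_space by simp
    show "{} \<notin> U \<inter> M"
      using U.F_empty by simp
    show "X \<inter> Y \<in> U \<inter> M" if "X \<in> U \<inter> M" "Y \<in> U \<inter> M" for X Y
      using that U.F_Int by blast
    show "Y \<in> U \<inter> M" if "X \<in> U \<inter> M" "Y \<in> M" "X \<subseteq> Y" for X Y
      using that U.F_mono \<open>M \<subseteq> N\<close> by blast
    show "X \<in> U \<inter> M \<or> \<Omega> - X \<in> U \<inter> M" if "X \<in> M" for X
      using that U.F_ultra \<open>M \<subseteq> N\<close> by blast
  qed simp
qed

lemma cylinders_subset_Pow: "cylinders B E \<subseteq> Pow (E \<rightarrow>\<^sub>E B)"
  unfolding cylinders_def by blast

lemma lift_map_in_PiE: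
  assumes "lifting B S U E l"
  shows "lift_map E l \<in> S \<rightarrow> (E \<rightarrow>\<^sub>E B)"
proof
  fix s assume "s \<in> S"
  then have "l e s \<in> B" if "e \<in> E" for e
    using assms that unfolding lifting_def by (blast intro: PiE_mem)
  then show "lift_map E l s \<in> E \<rightarrow>\<^sub>E B"
    by (simp add: lift_map_def)
qed

lemma lim_rim_induced_L:
  assumes "set_ultrafilter S (Pow S) U" and "lifting B S U E l"
  shows "lim_rim B E (induced_L B S U E l)"
  unfolding lim_rim_def induced_L_def
  by (rule set_ultrafilter_restrict[OF set_ultrafilter_pushforward[OF assms(1)
          lift_map_in_PiE[OF assms(2)]] algebra_cylinders cylinders_subset_Pow])

text \<open>Satisfaction modulo \<open>U\<close> may be tested on the representatives that the lifting provides,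
  and for these the two events correspond under \<open>lift_map E l\<close>.\<close>

lemma star_satisfies_induced_L:
  assumes U: "set_ultrafilter S (Pow S) U" and l: "lifting B S U E l" and es: "set es \<subseteq> E"
  shows "star_satisfies B E (induced_L B S U E l) R es \<longleftrightarrow> satisfies_mod B S U R es"
proof -
  let ?A = "{\<psi> \<in> E \<rightarrow>\<^sub>E B. map \<psi> es \<in> R}"
  have "map (lift_map E l s) es = map (\<lambda>f. f s) (map l es)" for s
    using es by (auto simp: lift_map_def)
  then have events: "{s \<in> S. lift_map E l s \<in> ?A} = {s \<in> S. map (\<lambda>f. f s) (map l es) \<in> R}"
    using lift_map_in_PiE[OF l] by (auto simp del: map_map)
  have classes: "map (ultra_class B S U) (map l es) = es"
    using l es by (auto simp: lifting_def intro!: map_idI)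
  have reps: "set (map l es) \<subseteq> S \<rightarrow>\<^sub>E B"
    using l es unfolding lifting_def by auto
  have "satisfies_mod B S U R es \<longleftrightarrow> {s \<in> S. map (\<lambda>f. f s) (map l es) \<in> R} \<in> U"
    by (rule satisfies_mod_classes[OF U reps, unfolded classes])
  also have "\<dots> \<longleftrightarrow> ?A \<in> pushforward S U (E \<rightarrow>\<^sub>E B) (lift_map E l)"
    unfolding pushforward_def events[symmetric] by blast
  also have "\<dots> \<longleftrightarrow> star_satisfies B E (induced_L B S U E l) R es"
    unfolding star_satisfies_def induced_L_def using tuple_event_cylinder[OF es] by blast
  finally show ?thesis
    by simp
qed

text \<open>A family of cylinders is determined by the tuples that \<open>*\<close>-satisfy each relation with
  respect to it, and here these are described without reference to the lifting.\<close>

lemma induced_L_lifting_independent: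
  assumes U: "set_ultrafilter S (Pow S) U"
    and l: "lifting B S U E l" and l': "lifting B S U E l'"
  shows "induced_L B S U E l = induced_L B S U E l'"
proof -
  have "X \<in> induced_L B S U E l \<longleftrightarrow> X \<in> induced_L B S U E l'" if X_cyl: "X \<in> cylinders B E" for X
  proof -
    obtain es R where es: "set es \<subseteq> E" and X: "X = {\<psi> \<in> E \<rightarrow>\<^sub>E B. map \<psi> es \<in> R}"
      using X_cyl unfolding cylinders_eq_tuple_events by blast
    show ?thesis
      using star_satisfies_induced_L[OF U l es, of R] star_satisfies_induced_L[OF U l' es, of R]
      unfolding star_satisfies_def X by simp
  qed
  moreover have "induced_L B S U E k \<subseteq> cylinders B E" for k
    unfolding induced_L_def by blast
  ultimately show ?thesis
    by blast
qed

text \<open>Evaluating the tuple of coordinate maps at \<open>\<psi>\<close> gives back the tuple of values of \<open>\<psi>\<close>,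
  so the two notions test the same event, once against \<open>L\<close> and once against \<open>U\<close>.\<close>

lemma star_satisfies_iff_satisfies_mod:
  assumes L: "lim_rim B E L" and U: "set_ultrafilter (E \<rightarrow>\<^sub>E B) (Pow (E \<rightarrow>\<^sub>E B)) U"
    and "L \<subseteq> U" and es: "set es \<subseteq> E"
  shows "star_satisfies B E L R es \<longleftrightarrow>
    satisfies_mod B (E \<rightarrow>\<^sub>E B) U R
      (map (\<lambda>e. ultra_class B (E \<rightarrow>\<^sub>E B) U (\<lambda>\<psi> \<in> E \<rightarrow>\<^sub>E B. \<psi> e)) es)"
proof -
  let ?\<Omega> = "E \<rightarrow>\<^sub>E B"
  let ?fs = "map (\<lambda>e. \<lambda>\<psi> \<in> ?\<Omega>. \<psi> e) es"
  have coord: "(\<lambda>\<psi> \<in> ?\<Omega>. \<psi> e) \<in> ?\<Omega> \<rightarrow>\<^sub>E B" if "e \<in> E" for e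
    by (intro restrict_PiE_iff[THEN iffD2] ballI) (rule PiE_mem[OF _ that])
  have coords: "set ?fs \<subseteq> ?\<Omega> \<rightarrow>\<^sub>E B"
    unfolding set_map by (intro image_subsetI coord) (rule subsetD[OF es])
  have "star_satisfies B E L R es \<longleftrightarrow> {\<psi> \<in> ?\<Omega>. map \<psi> es \<in> R} \<in> U"
    unfolding star_satisfies_def
    by (rule ultrafilter_extension_iff[OF L[unfolded lim_rim_def] U \<open>L \<subseteq> U\<close>
          tuple_event_cylinder[OF es]])
  also have "{\<psi> \<in> ?\<Omega>. map \<psi> es \<in> R} = {\<psi> \<in> ?\<Omega>. map (\<lambda>f. f \<psi>) ?fs \<in> R}"
    by (auto simp: comp_def)
  also have "\<dots> \<in> U \<longleftrightarrow> satisfies_mod B ?\<Omega> U R (map (ultra_class B ?\<Omega> U) ?fs)"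
    by (rule satisfies_mod_classes[OF U coords, symmetric])
  finally show ?thesis
    by (simp add: comp_def)
qed

theorem mainTheorem6:
  fixes B :: "'b set"
  assumes "infinite B"
  shows
    "(\<forall>(E :: 'e set) L U.
        lim_rim B E L \<and> set_ultrafilter (E \<rightarrow>\<^sub>E B) (Pow (E \<rightarrow>\<^sub>E B)) U \<and> L \<subseteq> U \<longrightarrow>
        (\<forall>n. \<forall>R \<subseteq> tuples B n. \<forall>es \<in> tuples E n.
           star_satisfies B E L R es \<longleftrightarrow>
           satisfies_mod B (E \<rightarrow>\<^sub>E B) U R
             (map (\<lambda>e. ultra_class B (E \<rightarrow>\<^sub>E B) U (\<lambda>\<psi> \<in> E \<rightarrow>\<^sub>E B. \<psi> e)) es)))
     \<and>
     (\<forall>(S :: 's set) U E.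
        set_ultrafilter S (Pow S) U \<and> E \<subseteq> ultrapower B S U \<longrightarrow>
        (\<forall>l l'. lifting B S U E l \<and> lifting B S U E l' \<longrightarrow>
           induced_L B S U E l = induced_L B S U E l') \<and>
        (\<forall>l. lifting B S U E l \<longrightarrow>
           set_ultrafilter (E \<rightarrow>\<^sub>E B) (Pow (E \<rightarrow>\<^sub>E B))
             (pushforward S U (E \<rightarrow>\<^sub>E B) (lift_map E l)) \<and>
           lim_rim B E (induced_L B S U E l) \<and>
           (\<forall>n. \<forall>R \<subseteq> tuples B n. \<forall>es \<in> tuples E n.
              star_satisfies B E (induced_L B S U E l) R es \<longleftrightarrow>
              satisfies_mod B S U R es)))"
proof (intro conjI allI impI ballI; (elim conjE)?)
qed (simp_all only: tuples_def mem_Collect_eq star_satisfies_iff_satisfies_mod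
    star_satisfies_induced_L lim_rim_induced_L set_ultrafilter_pushforward lift_map_in_PiE,
    rule induced_L_lifting_independent)

end
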